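(* Let $G$ be a nontrivial additive subgroup of $\mathbb C$. A linear map $\psi:\widehat W(G)\to\widehat W(G)$ is a $\frac12$-derivation of the Lie algebra $\widehat W(G)$ if and only if $\psi=c\,\mathrm{Id}+\varphi$ for some $c\in\mathbb C$ and some linear map $\varphi$ of the form $$\varphi(L_{\alpha,i})=\sum_{d\in G}\sum_{k\ge 1}a^{d,k}L_{\alpha+d,i+k}\quad(\alpha\in G,\ i\in\mathbb Z_+),\qquad \varphi(C)=0,$$ where $(a^{d,k})_{d\in G,\,k\ge1}$ is a family of complex numbers with only finitely many nonzero members.
   Context: All vector spaces are over $\mathbb C$, and $\mathbb Z_+=\{0,1,2,\dots\}$. A $\frac12$-derivation of a Lie algebra $\mathfrak L$ is a linear map $\varphi:\mathfrak L\to\mathfrak L$ with $\varphi([x,y])=\frac12([\varphi(x),y]+[x,\varphi(y)])$ for all $x,y$. $\widehat W(G)$ is the Lie algebra with basis $\{L_{\alpha,i}\mid\alpha\in G,\ i\in\mathbb Z_+\}\cup\{C\}$, with $C$ central and $$[L_{\alpha,i},L_{\beta,j}]=(\beta-\alpha)L_{\alpha+\beta,i+j}+(j-i)L_{\alpha+\beta,i+j+1}+\delta_{\alpha,-\beta}\delta_{i,-j}\tfrac{\alpha^3-\alpha}{12}C.$$ (Since $i,j\ge0$, $\delta_{i,-j}=1$ only when $i=j=0$.) *)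

theory Defs
  imports Complex_Main "HOL-Library.Poly_Mapping"
begin

section \<open>Lie algebras and half-derivations on a subspace\<close>

text \<open>
  The Lie algebras below are subspaces \<open>V\<close>, depending on a subgroup of the complex numbers, of one
  ambient complex vector space. All notions are therefore relative to a carrier \<open>V\<close>; values of maps
  outside of \<open>V\<close> are irrelevant.
\<close>

definition linear_map_on ::
  "(complex \<Rightarrow> 'a \<Rightarrow> 'a) \<Rightarrow> 'a::ab_group_add set \<Rightarrow> ('a \<Rightarrow> 'a) \<Rightarrow> bool" where
  "linear_map_on scale V f \<longleftrightarrow>
     (\<forall>x\<in>V. f x \<in> V) \<and>
     (\<forall>x\<in>V. \<forall>y\<in>V. f (x + y) = f x + f y) \<and>
     (\<forall>c. \<forall>x\<in>V. f (scale c x) = scale c (f x))"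

definition lie_algebra_on ::
  "(complex \<Rightarrow> 'a \<Rightarrow> 'a) \<Rightarrow> 'a::ab_group_add set \<Rightarrow> ('a \<Rightarrow> 'a \<Rightarrow> 'a) \<Rightarrow> bool" where
  "lie_algebra_on scale V br \<longleftrightarrow>
     vector_space scale \<and> module.subspace scale V \<and>
     (\<forall>x\<in>V. linear_map_on scale V (br x)) \<and>
     (\<forall>y\<in>V. linear_map_on scale V (\<lambda>x. br x y)) \<and>
     (\<forall>x\<in>V. br x x = 0) \<and>
     (\<forall>x\<in>V. \<forall>y\<in>V. \<forall>z\<in>V. br x (br y z) + br y (br z x) + br z (br x y) = 0)"

definition half_derivation_on ::
  "(complex \<Rightarrow> 'a \<Rightarrow> 'a) \<Rightarrow> 'a::ab_group_add set \<Rightarrow> ('a \<Rightarrow> 'a \<Rightarrow> 'a) \<Rightarrow> ('a \<Rightarrow> 'a) \<Rightarrow> bool" where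
  "half_derivation_on scale V br \<phi> \<longleftrightarrow>
     linear_map_on scale V \<phi> \<and>
     (\<forall>x\<in>V. \<forall>y\<in>V. \<phi> (br x y) = scale (1/2) (br (\<phi> x) y + br x (\<phi> y)))"


section \<open>The Lie algebra $\widehat W(G)$\<close>

definition complex_add_subgroup :: "complex set \<Rightarrow> bool" where
  "complex_add_subgroup G \<longleftrightarrow> 0 \<in> G \<and> (\<forall>x\<in>G. \<forall>y\<in>G. x + y \<in> G) \<and> (\<forall>x\<in>G. - x \<in> G)"

datatype what_index = IL complex nat | IC

type_synonym what = "what_index \<Rightarrow>\<^sub>0 complex"

definition scaleW :: "complex \<Rightarrow> what \<Rightarrow> what" where
  "scaleW c x = Poly_Mapping.map ((*) c) x"

definition L :: "complex \<Rightarrow> nat \<Rightarrow> what" where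
  "L \<alpha> i = Poly_Mapping.single (IL \<alpha> i) 1"

definition C :: what where
  "C = Poly_Mapping.single IC 1"

definition What :: "complex set \<Rightarrow> what set" where
  "What G = {x. Poly_Mapping.keys x \<subseteq> {IL \<alpha> i | \<alpha> i. \<alpha> \<in> G} \<union> {IC}}"

fun basis_bracket :: "what_index \<Rightarrow> what_index \<Rightarrow> what" where
  "basis_bracket (IL \<alpha> i) (IL \<beta> j) =
     scaleW (\<beta> - \<alpha>) (L (\<alpha> + \<beta>) (i + j))
     + scaleW (of_nat j - of_nat i) (L (\<alpha> + \<beta>) (i + j + 1))
     + (if \<alpha> = - \<beta> \<and> int i = - int j then scaleW ((\<alpha> ^ 3 - \<alpha>) / 12) C else 0)"
| "basis_bracket IC _ = 0"
| "basis_bracket _ IC = 0"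

text \<open>The bilinear extension of \<^const>\<open>basis_bracket\<close>:\<close>

definition bracketW :: "what \<Rightarrow> what \<Rightarrow> what" where
  "bracketW x y =
     (\<Sum>p\<in>Poly_Mapping.keys x. \<Sum>q\<in>Poly_Mapping.keys y.
        scaleW (Poly_Mapping.lookup x p * Poly_Mapping.lookup y q) (basis_bracket p q))"


section \<open>Basic facts\<close>

lemma lookup_scaleW [simp]:
  "Poly_Mapping.lookup (scaleW c x) k = c * Poly_Mapping.lookup x k"
  by (simp add: scaleW_def Poly_Mapping.map.rep_eq when_def)

interpretation scaleW: vector_space scaleW
  by unfold_locales (auto intro!: poly_mapping_eqI simp: lookup_add algebra_simps)

lemma scaleW_single: "scaleW c (Poly_Mapping.single p d) = Poly_Mapping.single p (c * d)"
  by (rule poly_mapping_eqI) (simp add: lookup_single when_def)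

lemma bracketW_superset:
  assumes "finite A" "finite B" "Poly_Mapping.keys x \<subseteq> A" "Poly_Mapping.keys y \<subseteq> B"
  shows "bracketW x y = (\<Sum>p\<in>A. \<Sum>q\<in>B.
     scaleW (Poly_Mapping.lookup x p * Poly_Mapping.lookup y q) (basis_bracket p q))"
proof -
  have "bracketW x y = (\<Sum>p\<in>Poly_Mapping.keys x. \<Sum>q\<in>B.
     scaleW (Poly_Mapping.lookup x p * Poly_Mapping.lookup y q) (basis_bracket p q))"
    unfolding bracketW_def using assms
    by (intro sum.cong[OF refl] sum.mono_neutral_left) (auto simp: in_keys_iff)
  also have "\<dots> = (\<Sum>p\<in>A. \<Sum>q\<in>B.
     scaleW (Poly_Mapping.lookup x p * Poly_Mapping.lookup y q) (basis_bracket p q))"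
    using assms by (intro sum.mono_neutral_left) (auto simp: in_keys_iff)
  finally show ?thesis .
qed

lemma bracketW_add_left: "bracketW (x + x') y = bracketW x y + bracketW x' y"
proof -
  let ?A = "Poly_Mapping.keys x \<union> Poly_Mapping.keys x'" and ?B = "Poly_Mapping.keys y"
  show ?thesis
    by (subst (1 2 3) bracketW_superset[of ?A ?B])
       (use Poly_Mapping.keys_add[of x x'] in
         \<open>auto simp: lookup_add distrib_right scaleW.scale_left_distrib sum.distrib\<close>)
qed

lemma bracketW_add_right: "bracketW x (y + y') = bracketW x y + bracketW x y'"
proof -
  let ?A = "Poly_Mapping.keys x" and ?B = "Poly_Mapping.keys y \<union> Poly_Mapping.keys y'"
  show ?thesis
    by (subst (1 2 3) bracketW_superset[of ?A ?B])
       (use Poly_Mapping.keys_add[of y y'] in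
         \<open>auto simp: lookup_add distrib_left scaleW.scale_left_distrib sum.distrib\<close>)
qed

lemma keys_scaleW: "Poly_Mapping.keys (scaleW c x) \<subseteq> Poly_Mapping.keys x"
  by (auto simp: in_keys_iff)

lemma bracketW_scale_left: "bracketW (scaleW c x) y = scaleW c (bracketW x y)"
  by (subst (1 2) bracketW_superset[of "Poly_Mapping.keys x" "Poly_Mapping.keys y"])
     (use keys_scaleW[of c x] in \<open>auto simp: scaleW.scale_sum_right mult.assoc\<close>)

lemma bracketW_scale_right: "bracketW x (scaleW c y) = scaleW c (bracketW x y)"
  by (subst (1 2) bracketW_superset[of "Poly_Mapping.keys x" "Poly_Mapping.keys y"])
     (use keys_scaleW[of c y] in \<open>auto simp: scaleW.scale_sum_right mult_ac\<close>)

lemma bracketW_zero [simp]: "bracketW 0 y = 0" "bracketW x 0 = 0"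
  by (simp_all add: bracketW_def)

lemma bracketW_single:
  "bracketW (Poly_Mapping.single p c) (Poly_Mapping.single q d) = scaleW (c * d) (basis_bracket p q)"
  by (subst bracketW_superset[of "{p}" "{q}"]) auto

lemma bracketW_L_L:
  "bracketW (L \<alpha> i) (L \<beta> j) =
     scaleW (\<beta> - \<alpha>) (L (\<alpha> + \<beta>) (i + j))
     + scaleW (of_nat j - of_nat i) (L (\<alpha> + \<beta>) (i + j + 1))
     + (if \<alpha> = - \<beta> \<and> int i = - int j then scaleW ((\<alpha> ^ 3 - \<alpha>) / 12) C else 0)"
  by (simp only: L_def bracketW_single basis_bracket.simps) simp

lemma bracketW_C [simp]: "bracketW C x = 0" "bracketW x C = 0"
proof -
  have "basis_bracket p IC = 0" for p by (cases p) auto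
  then show "bracketW C x = 0" "bracketW x C = 0" by (simp_all add: bracketW_def C_def)
qed

lemma what_induct [case_names zero add_L add_C]:
  assumes zero: "P 0"
    and L: "\<And>c \<alpha> i x. P x \<Longrightarrow> P (scaleW c (L \<alpha> i) + x)"
    and C: "\<And>c x. P x \<Longrightarrow> P (scaleW c C + x)"
  shows "P x"
proof -
  have "P (\<Sum>p\<in>A. scaleW (Poly_Mapping.lookup x p) (Poly_Mapping.single p 1))" if "finite A" for A
    using that
  proof (induction A rule: finite_induct)
    case (insert p A)
    then show ?case using L C by (cases p) (auto simp: L_def C_def)
  qed (use zero in simp)
  moreover have "x = (\<Sum>p\<in>Poly_Mapping.keys x.
      scaleW (Poly_Mapping.lookup x p) (Poly_Mapping.single p 1))"
    by (rule poly_mapping_eqI)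
       (simp add: lookup_sum lookup_single when_def in_keys_iff if_distrib cong: if_cong)
  ultimately show ?thesis by (metis finite_keys)
qed

lemma bracketW_skew: "bracketW x y = - bracketW y x"
proof -
  have LL: "bracketW (L \<alpha> i) (L \<beta> j) = - bracketW (L \<beta> j) (L \<alpha> i)" for \<alpha> \<beta> i j
  proof (cases "\<alpha> = - \<beta> \<and> int i = - int j")
    case True
    then show ?thesis
      unfolding bracketW_L_L
      by (intro poly_mapping_eqI)
         (auto simp: lookup_add lookup_minus add.commute algebra_simps diff_divide_distrib)
  next
    case False
    then have "\<not> (\<beta> = - \<alpha> \<and> int j = - int i)" by auto
    with False show ?thesis
      unfolding bracketW_L_L
      by (simp only: if_False, intro poly_mapping_eqI)
         (simp add: lookup_add lookup_minus add.commute algebra_simps)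
  qed
  have Ly: "bracketW (L \<alpha> i) y = - bracketW y (L \<alpha> i)" for \<alpha> i y
    by (induction y rule: what_induct)
       (simp_all add: bracketW_add_left bracketW_add_right bracketW_scale_left
          bracketW_scale_right, simp add: LL[of \<alpha> i])
  show ?thesis
    by (induction x rule: what_induct)
       (simp_all add: bracketW_add_left bracketW_add_right bracketW_scale_left
          bracketW_scale_right, simp add: Ly)
qed

lemma bracketW_self: "bracketW x x = 0"
proof (rule poly_mapping_eqI)
  fix k
  have "Poly_Mapping.lookup (bracketW x x) k = - Poly_Mapping.lookup (bracketW x x) k"
    using bracketW_skew[of x x] by (metis lookup_uminus)
  then show "Poly_Mapping.lookup (bracketW x x) k = Poly_Mapping.lookup 0 k" by simp
qed

abbreviation (input) jacobiW :: "what \<Rightarrow> what \<Rightarrow> what \<Rightarrow> what" where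
  "jacobiW x y z \<equiv>
     bracketW x (bracketW y z) + bracketW y (bracketW z x) + bracketW z (bracketW x y)"

lemma bracketW_jacobi_basis: "jacobiW (L \<alpha> i) (L \<beta> j) (L \<gamma> k) = 0"
proof -
  have br: "bracketW (L a m) (bracketW (L b n) (L c r)) =
      Poly_Mapping.single (IL (a + b + c) (m + n + r)) ((c - b) * (b + c - a))
    + Poly_Mapping.single (IL (a + b + c) (m + n + r + 1))
        ((c - b) * (of_nat n + of_nat r - of_nat m) + (of_nat r - of_nat n) * (b + c - a))
    + Poly_Mapping.single (IL (a + b + c) (m + n + r + 2))
        ((of_nat r - of_nat n) * (of_nat n + of_nat r + 1 - of_nat m))
    + Poly_Mapping.single IC
        (if a + b + c = 0 \<and> m + n + r = 0 then (c - b) * ((a ^ 3 - a) / 12) else 0)"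
    for a b c m n r
  proof -
    have eq: "a = - (b + c) \<longleftrightarrow> a + b + c = 0" by (simp only: eq_neg_iff_add_eq_0 add.assoc)
    have C0: "bracketW (L a m) (if P then scaleW s C else 0) = 0" for P s
      by (simp add: bracketW_scale_right)
    have "bracketW (L a m) (bracketW (L b n) (L c r)) =
        scaleW (c - b) (bracketW (L a m) (L (b + c) (n + r)))
        + scaleW (of_nat r - of_nat n) (bracketW (L a m) (L (b + c) (n + r + 1)))"
      by (subst bracketW_L_L) (simp only: bracketW_add_right bracketW_scale_right C0 add_0_right)
    moreover have "bracketW (L a m) (L (b + c) (n + r)) =
        Poly_Mapping.single (IL (a + b + c) (m + n + r)) (b + c - a)
        + Poly_Mapping.single (IL (a + b + c) (m + n + r + 1)) (of_nat n + of_nat r - of_nat m)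
        + Poly_Mapping.single IC (if a + b + c = 0 \<and> m + n + r = 0 then (a ^ 3 - a) / 12 else 0)"
    proof -
      have "int m = - int (n + r) \<longleftrightarrow> m + n + r = 0" by auto
      then show ?thesis
        unfolding bracketW_L_L eq by (simp add: L_def C_def scaleW_single add.assoc)
    qed
    moreover have "bracketW (L a m) (L (b + c) (n + r + 1)) =
        Poly_Mapping.single (IL (a + b + c) (m + n + r + 1)) (b + c - a)
        + Poly_Mapping.single (IL (a + b + c) (m + n + r + 2)) (of_nat n + of_nat r + 1 - of_nat m)"
    proof -
      have "\<not> int m = - int (n + r + 1)" by auto
      then show ?thesis
        unfolding bracketW_L_L by (simp add: L_def scaleW_single add_ac)
    qed
    ultimately show ?thesis
      by (simp add: scaleW.scale_right_distrib scaleW_single single_add add_ac del: of_nat_add)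
  qed
  have rot: "\<beta> + \<gamma> + \<alpha> = \<alpha> + \<beta> + \<gamma>" "\<gamma> + \<alpha> + \<beta> = \<alpha> + \<beta> + \<gamma>"
    "j + k + i = i + j + k" "k + i + j = i + j + k" by simp_all
  have cyc: "(\<gamma> - \<beta>) * ((\<alpha> ^ 3 - \<alpha>) / 12) + (\<alpha> - \<gamma>) * ((\<beta> ^ 3 - \<beta>) / 12)
      + (\<beta> - \<alpha>) * ((\<gamma> ^ 3 - \<gamma>) / 12) = 0" if "\<alpha> + \<beta> + \<gamma> = 0"
  proof -
    have \<gamma>: "\<gamma> = - \<alpha> - \<beta>" using that by algebra
    show ?thesis unfolding \<gamma> by (simp add: field_simps power3_eq_cube)
  qed
  have collect: "(single p u0 + single q u1 + single r u2 + single s u3)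
      + (single p v0 + single q v1 + single r v2 + single s v3)
      + (single p w0 + single q w1 + single r w2 + single s w3)
    = single p (u0 + v0 + w0) + single q (u1 + v1 + w1) + single r (u2 + v2 + w2)
      + single s (u3 + v3 + w3)"
    if "single = (Poly_Mapping.single :: what_index \<Rightarrow> complex \<Rightarrow> what)"
    for p q r s u0 u1 u2 u3 v0 v1 v2 v3 w0 w1 w2 w3 and single
    unfolding that single_add by (simp only: add_ac)
  have zero: "Poly_Mapping.single p u + Poly_Mapping.single q v + Poly_Mapping.single r w
      + Poly_Mapping.single s t = 0" if "u = 0" "v = 0" "w = 0" "t = 0"
    for p q r s :: what_index and u v w t :: complex
    using that by simp
  show ?thesis
    unfolding br rot collect[OF refl]
    by (rule zero; (simp add: algebra_simps; fail | use cyc in auto))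
qed

lemma bracketW_jacobi: "jacobiW x y z = 0"
proof -
  note bil = bracketW_add_left bracketW_add_right bracketW_scale_left bracketW_scale_right
  have aux: "jacobiW x y z = 0"
    if "x = scaleW c u + v" "jacobiW u y z = 0" "jacobiW v y z = 0" for c u v x y z
  proof -
    have "jacobiW x y z = scaleW c (jacobiW u y z) + jacobiW v y z"
      by (simp add: that(1) bil scaleW.scale_right_distrib algebra_simps)
    then show ?thesis by (simp add: that)
  qed
  have cyc: "jacobiW x y z = jacobiW y z x" for x y z by (simp add: add_ac)
  have ind: "jacobiW x y z = 0" if "\<And>\<alpha> i. jacobiW (L \<alpha> i) y z = 0" for x y z
  proof (induction x rule: what_induct)
    case (add_L c \<alpha> i x)
    show ?case by (rule aux[OF refl that add_L])
  next
    case (add_C c x)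
    show ?case by (rule aux[OF refl _ add_C]) simp
  qed simp
  have 1: "jacobiW x (L \<beta> j) (L \<gamma> k) = 0" for x \<beta> j \<gamma> k
    by (rule ind) (rule bracketW_jacobi_basis)
  have 2: "jacobiW y (L \<gamma> k) x = 0" for x y \<gamma> k
    by (rule ind) (subst cyc, subst cyc, rule 1)
  show ?thesis
    by (rule ind) (subst cyc, subst cyc, rule 2)
qed

lemma subspace_What: "scaleW.subspace (What G)"
  unfolding scaleW.subspace_def What_def
  using Poly_Mapping.keys_add keys_scaleW by fastforce

lemma L_in_What: "\<alpha> \<in> G \<Longrightarrow> L \<alpha> i \<in> What G" and C_in_What: "C \<in> What G"
  by (auto simp: What_def L_def C_def)

lemma bracketW_in_What:
  assumes "complex_add_subgroup G" "x \<in> What G" "y \<in> What G"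
  shows "bracketW x y \<in> What G"
proof -
  have "basis_bracket p q \<in> What G"
    if "p \<in> Poly_Mapping.keys x" "q \<in> Poly_Mapping.keys y" for p q
  proof (cases "(p, q)" rule: basis_bracket.cases)
    case (1 \<alpha> i \<beta> j)
    then have "\<alpha> \<in> G" "\<beta> \<in> G" using that assms(2,3) by (auto simp: What_def)
    then have "\<alpha> + \<beta> \<in> G" using assms(1) by (simp add: complex_add_subgroup_def)
    then have "L (\<alpha> + \<beta>) n \<in> What G" for n by (rule L_in_What)
    then show ?thesis using 1
      by (auto intro!: scaleW.subspace_add[OF subspace_What]
            scaleW.subspace_scale[OF subspace_What] C_in_What)
  qed (auto intro: scaleW.subspace_0[OF subspace_What])
  then show ?thesis
    unfolding bracketW_def
    by (intro scaleW.subspace_sum[OF subspace_What] scaleW.subspace_scale[OF subspace_What])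
qed

lemma lie_algebra_What:
  assumes "complex_add_subgroup G"
  shows "lie_algebra_on scaleW (What G) bracketW"
  unfolding lie_algebra_on_def linear_map_on_def
  using subspace_What bracketW_in_What[OF assms] bracketW_jacobi
  by (auto simp: bracketW_add_left bracketW_add_right bracketW_scale_left bracketW_scale_right
      bracketW_self intro: scaleW.vector_space_axioms)

end

theory Submission
  imports Defs "HOL-Library.Product_Plus"
begin

text \<open>
  Modulo the centre, the algebra is \<open>A D\<close> for the commutative ring \<open>A = \<complex>[G] \<otimes> \<complex>[t]\<close> and the
  derivation \<open>D (x\<^sup>\<alpha> t\<^sup>i) = (\<alpha> + i t) x\<^sup>\<alpha> t\<^sup>i\<close>, with bracket \<open>[f, g] = f D g - g D f\<close>. Multiplication by
  any \<open>u \<in> A\<close> is a half-derivation. Subtracting multiplication by \<open>\<phi> 1\<close> one may assume \<open>\<phi> 1 = 0\<close>; then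
  \<open>\<phi> D = D \<phi> / 2\<close>, and applying \<open>\<phi>\<close> to the Jacobi identity for \<open>1, f, g\<close> gives
  \<open>[D f, \<phi> g] + [\<phi> f, D g] = 0\<close>. With \<open>f = x\<^sup>\<alpha>\<close> and \<open>g = f\<^sup>2\<close> this yields \<open>\<phi> g = 0\<close>, and then, with \<open>g\<close> in
  the role of \<open>f\<close>, that \<open>D \<phi> = 2 \<alpha> \<phi>\<close>. As \<open>\<alpha>\<close> may be replaced by \<open>- \<alpha>\<close>, \<open>\<phi> = 0\<close>. Comparing central
  components finally forces the \<open>t\<close>-free part of \<open>u\<close> to be a constant.
\<close>

section \<open>The monomial ring and its derivation\<close>

text \<open>The exponent \<open>(\<alpha>, i)\<close> stands for \<open>x\<^sup>\<alpha> t\<^sup>i\<close>; all exponents in \<open>\<complex>\<close> are allowed, not only those in \<open>G\<close>.\<close>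

type_synonym group_poly = "(complex \<times> nat) \<Rightarrow>\<^sub>0 complex"

lemma poly_mapping_single_sum_induct [case_names single sum]:
  fixes p :: "'a \<Rightarrow>\<^sub>0 'b::comm_monoid_add"
  assumes single: "\<And>k c. P (Poly_Mapping.single k c)" and sum: "\<And>p q. P p \<Longrightarrow> P q \<Longrightarrow> P (p + q)"
  shows "P p"
proof -
  let ?t = "\<lambda>k. Poly_Mapping.single k (Poly_Mapping.lookup p k)"
  have "P (sum ?t A)" if "finite A" for A
    \<comment> \<open>The empty sum is treated as a monomial with coefficient 0, so the rule gets by
      without a zero case.\<close>
    using that by (induction A rule: finite_induct) (use single[of _ 0] in \<open>auto intro: single sum\<close>)
  moreover have "p = sum ?t (Poly_Mapping.keys p)"
    by (rule poly_mapping_eqI) (simp add: lookup_sum lookup_single when_def in_keys_iff)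
  ultimately show ?thesis by (metis finite_keys)
qed

definition weight :: "(complex \<times> nat \<Rightarrow> complex) \<Rightarrow> group_poly \<Rightarrow> group_poly" where
  "weight w = Poly_Mapping.mapp (\<lambda>k c. w k * c)"

lemma lookup_weight [simp]: "Poly_Mapping.lookup (weight w p) k = w k * Poly_Mapping.lookup p k"
  by (simp add: weight_def lookup_mapp when_def in_keys_iff)

lemma weight_add: "weight w (p + q) = weight w p + weight w q"
  by (rule poly_mapping_eqI) (simp add: lookup_add algebra_simps)

lemma weight_single: "weight w (Poly_Mapping.single k c) = Poly_Mapping.single k (w k * c)"
  by (rule poly_mapping_eqI) (simp add: lookup_single when_def)

text \<open>On monomials the product rule is additivity of the weight in the exponent; bilinearity
  extends it.\<close>

lemma weight_mult:
  assumes "\<And>k l. w (k + l) = w k + w l"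
  shows "weight w (p * q) = p * weight w q + weight w p * q"
proof (induction p rule: poly_mapping_single_sum_induct)
  case (single k c)
  show ?case
    by (induction q rule: poly_mapping_single_sum_induct)
       (simp_all add: weight_single mult_single assms weight_add algebra_simps flip: single_add)
qed (simp add: weight_add algebra_simps)

text \<open>\<open>Poly_Mapping.single (0, 1) 1\<close> is the variable t, so the second summand is
  t times the Euler operator of t, that is, the derivation t^2 d/dt.\<close>

definition D :: "group_poly \<Rightarrow> group_poly" where
  "D p = weight fst p + Poly_Mapping.single (0, 1) 1 * weight (of_nat \<circ> snd) p"

lemma D_add: "D (p + q) = D p + D q"
  by (simp add: D_def weight_add algebra_simps)

lemma D_mult: "D (p * q) = p * D q + D p * q"
  by (simp add: D_def weight_mult algebra_simps)

lemma D_single: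
  "D (Poly_Mapping.single (\<alpha>, i) c) =
     Poly_Mapping.single (\<alpha>, i) (\<alpha> * c) + Poly_Mapping.single (\<alpha>, i + 1) (of_nat i * c)"
  by (simp add: D_def weight_single mult_single)

abbreviation scalar :: "complex \<Rightarrow> group_poly" where
  "scalar \<equiv> Poly_Mapping.single 0"

lemma D_scalar [simp]: "D (scalar c) = 0"
  by (simp add: zero_prod_def D_single)

lemma D_diff: "D (p - q) = D p - D q"
  by (metis D_add add_diff_cancel diff_add_cancel)

lemma D_zero [simp]: "D 0 = 0"
  by (metis D_diff diff_self)

section \<open>Passage to the quotient by \<open>C\<close>\<close>

text \<open>Pulling coefficients back along the embedding of exponents forgets only the one at
  \<open>IC\<close>, so this is the quotient map by the span of \<open>C\<close>.\<close>

definition proj :: "what \<Rightarrow> group_poly" where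
  "proj = Poly_Mapping.map_key (\<lambda>(\<alpha>, i). IL \<alpha> i)"

lemma lookup_proj [simp]: "Poly_Mapping.lookup (proj x) (\<alpha>, i) = Poly_Mapping.lookup x (IL \<alpha> i)"
  by (simp add: proj_def map_key.rep_eq inj_def)

lemma proj_add: "proj (x + y) = proj x + proj y"
  by (rule poly_mapping_eqI) (auto simp: lookup_add)

lemma lookup_scalar_mult [simp]: "Poly_Mapping.lookup (scalar c * p) k = c * Poly_Mapping.lookup p k"
proof (induction p rule: poly_mapping_single_sum_induct)
  case (single l d)
  then show ?case by (simp add: mult_single lookup_single when_def)
qed (simp add: lookup_add algebra_simps)

lemma proj_scale: "proj (scaleW c x) = scalar c * proj x"
  by (rule poly_mapping_eqI) auto

lemma proj_L: "proj (L \<alpha> i) = Poly_Mapping.single (\<alpha>, i) 1"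
  by (rule poly_mapping_eqI) (auto simp: L_def lookup_single when_def split: if_splits)

lemma proj_C [simp]: "proj C = 0"
  by (rule poly_mapping_eqI) (auto simp: C_def lookup_single when_def)

lemma proj_zero [simp]: "proj 0 = 0"
  by (rule poly_mapping_eqI) auto

text \<open>The coefficient in the commutator of vector fields: [p D, q D] = (p D q - q D p)
  D.\<close>

definition wronskian :: "group_poly \<Rightarrow> group_poly \<Rightarrow> group_poly" where
  "wronskian p q = p * D q - q * D p"

lemma wronskian_add:
    "wronskian (p + p') q = wronskian p q + wronskian p' q"
    "wronskian p (q + q') = wronskian p q + wronskian p q'"
  and wronskian_diff:
    "wronskian (p - p') q = wronskian p q - wronskian p' q"
    "wronskian p (q - q') = wronskian p q - wronskian p q'"
  and wronskian_scale:
    "wronskian (scalar c * p) q = scalar c * wronskian p q"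
    "wronskian p (scalar c * q) = scalar c * wronskian p q"
  and wronskian_zero [simp]: "wronskian 0 q = 0" "wronskian p 0 = 0"
  by (simp_all add: wronskian_def D_add D_diff D_mult algebra_simps)

text \<open>The two terms containing \<open>D u\<close> are \<open>p * q * D u\<close> with opposite
  signs. What remains makes multiplication by any \<open>u\<close> a half-derivation of the quotient
  bracket.\<close>

lemma wronskian_mult: "wronskian (u * p) q + wronskian p (u * q) = 2 * (u * wronskian p q)"
  by (simp add: wronskian_def D_mult algebra_simps)

text \<open>\<open>D\<close> is bracketing with 1, so this is the Jacobi identity for 1,
  \<open>p\<close>, \<open>q\<close>.\<close>

lemma D_pbr: "D (wronskian p q) = wronskian (D p) q + wronskian p (D q)"
  by (simp add: wronskian_def D_mult D_diff algebra_simps)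

lemma proj_bracketW: "proj (bracketW x y) = wronskian (proj x) (proj y)"
proof -
  have LL: "proj (bracketW (L \<alpha> i) (L \<beta> j)) = wronskian (proj (L \<alpha> i)) (proj (L \<beta> j))" for \<alpha> i \<beta> j
  proof -
    have "proj (if P then scaleW s C else 0) = 0" for P s
      by (simp add: proj_scale)
    then show ?thesis
      unfolding bracketW_L_L proj_add proj_scale proj_L
      by (simp add: wronskian_def D_single mult_single algebra_simps flip: single_add single_diff)
  qed
  have Ly: "proj (bracketW (L \<alpha> i) y) = wronskian (proj (L \<alpha> i)) (proj y)" for \<alpha> i y
    by (induction y rule: what_induct)
       (simp_all add: LL bracketW_add_right bracketW_scale_right proj_add proj_scale wronskian_add wronskian_scale)
  show ?thesis
    by (induction x rule: what_induct)
       (simp_all add: Ly bracketW_add_left bracketW_scale_left proj_add proj_scale wronskian_add wronskian_scale)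
qed

lemma scalar_mult_cancel: "c \<noteq> 0 \<Longrightarrow> scalar c * p = scalar c * q \<longleftrightarrow> p = q"
  by (metis lookup_scalar_mult mult_cancel_left poly_mapping_eqI)

text \<open>An induction that stays inside \<open>What G\<close>, since the maps under study are
  controlled only there.\<close>

lemma What_induct [consumes 1, case_names zero add_L add_C]:
  assumes "x \<in> What G"
    and zero: "P 0"
    and L: "\<And>c \<alpha> i x. \<alpha> \<in> G \<Longrightarrow> x \<in> What G \<Longrightarrow> P x \<Longrightarrow> P (scaleW c (L \<alpha> i) + x)"
    and C: "\<And>c x. x \<in> What G \<Longrightarrow> P x \<Longrightarrow> P (scaleW c C + x)"
  shows "P x"
proof -
  let ?t = "\<lambda>p. scaleW (Poly_Mapping.lookup x p) (Poly_Mapping.single p 1)"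
  have "sum ?t A \<in> What G \<and> P (sum ?t A)"
    if "finite A" "A \<subseteq> Poly_Mapping.keys x" for A
    using that
  proof (induction A rule: finite_induct)
    case (insert p A)
    then have "p \<in> {IL \<alpha> i | \<alpha> i. \<alpha> \<in> G} \<union> {IC}"
      using assms(1) by (auto simp: What_def)
    then consider \<alpha> i where "\<alpha> \<in> G" "p = IL \<alpha> i" | "p = IC" by auto
    then show ?case
    proof cases
      case 1
      with insert L show ?thesis
        by (auto simp flip: L_def intro!: scaleW.subspace_add[OF subspace_What]
            scaleW.subspace_scale[OF subspace_What] L_in_What)
    next
      case 2
      with insert C show ?thesis
        by (auto simp flip: C_def intro!: scaleW.subspace_add[OF subspace_What]
            scaleW.subspace_scale[OF subspace_What] C_in_What)
    qed
  qed (use zero scaleW.subspace_0[OF subspace_What] in simp)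
  moreover have "x = sum ?t (Poly_Mapping.keys x)"
    by (rule poly_mapping_eqI)
       (simp add: lookup_sum lookup_single when_def in_keys_iff if_distrib cong: if_cong)
  ultimately show ?thesis by (metis finite_keys order_refl)
qed

section \<open>Rigidity: half-derivations vanishing at the unit\<close>

text \<open>Values in the ring, rather than in \<open>what\<close>, allow the choice of
  \<open>proj (\<psi> x) - u * proj x\<close> for \<open>\<Phi> x\<close>.\<close>

lemma half_derivation_rigid:
  fixes \<Phi> :: "what \<Rightarrow> group_poly"
  assumes G: "complex_add_subgroup G" and nontrivial: "G \<noteq> {0}"
    and add: "\<And>x y. x \<in> What G \<Longrightarrow> y \<in> What G \<Longrightarrow> \<Phi> (x + y) = \<Phi> x + \<Phi> y"
    and scale: "\<And>c x. x \<in> What G \<Longrightarrow> \<Phi> (scaleW c x) = scalar c * \<Phi> x"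
    and half: "\<And>x y. x \<in> What G \<Longrightarrow> y \<in> What G \<Longrightarrow>
      2 * \<Phi> (bracketW x y) = wronskian (\<Phi> x) (proj y) + wronskian (proj x) (\<Phi> y)"
    and unit: "\<Phi> (L 0 0) = 0"
    and x: "x \<in> What G"
  shows "\<Phi> x = 0"
proof -
  let ?e = "L 0 0"
  have e: "?e \<in> What G" using G by (simp add: complex_add_subgroup_def L_in_What)
  have one: "proj ?e = 1" by (simp add: proj_L flip: zero_prod_def)
  have pe: "proj (bracketW ?e x) = D (proj x)" for x
    using D_scalar[of 1] by (simp add: proj_bracketW one wronskian_def)
  have \<Phi>e: "2 * \<Phi> (bracketW ?e x) = D (\<Phi> x)" if "x \<in> What G" for x
    using half[OF e that] D_scalar[of 1] by (simp add: unit one wronskian_def)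
  note br = bracketW_in_What[OF G]
  \<comment> \<open>Four times \<open>\<Phi>\<close> of [e, [x, y]] is computed in two ways: as
    \<open>D\<close> of twice \<open>\<Phi>\<close> of [x, y], and after expanding by the Jacobi
    identity.\<close>
  have cross: "wronskian (D (proj x)) (\<Phi> y) + wronskian (\<Phi> x) (D (proj y)) = 0"
    if x: "x \<in> What G" and y: "y \<in> What G" for x y
  proof -
    have "bracketW ?e (bracketW x y) = bracketW (bracketW ?e x) y + bracketW x (bracketW ?e y)"
      using bracketW_jacobi[of ?e x y] bracketW_skew[of y "bracketW ?e x"] bracketW_skew[of y ?e]
        bracketW_scale_right[of x "-1" "bracketW ?e y"]
      by (simp add: algebra_simps)
    then have "\<Phi> (bracketW ?e (bracketW x y)) =
        \<Phi> (bracketW (bracketW ?e x) y) + \<Phi> (bracketW x (bracketW ?e y))"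
      using add x y e br by simp
    moreover have "2 * \<Phi> (bracketW ?e (bracketW x y)) = D (\<Phi> (bracketW x y))"
      using \<Phi>e x y br by simp
    moreover have "2 * D (\<Phi> (bracketW x y)) = D (wronskian (\<Phi> x) (proj y)) + D (wronskian (proj x) (\<Phi> y))"
      using half[OF x y] by (metis D_add mult_2)
    moreover have "2 * \<Phi> (bracketW (bracketW ?e x) y) =
        wronskian (\<Phi> (bracketW ?e x)) (proj y) + wronskian (D (proj x)) (\<Phi> y)"
      using half[of "bracketW ?e x" y] x y e br by (simp add: pe)
    moreover have "2 * \<Phi> (bracketW x (bracketW ?e y)) =
        wronskian (\<Phi> x) (D (proj y)) + wronskian (proj x) (\<Phi> (bracketW ?e y))"
      using half[of x "bracketW ?e y"] x y e br by (simp add: pe)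
    moreover have "2 * wronskian (\<Phi> (bracketW ?e x)) (proj y) = wronskian (D (\<Phi> x)) (proj y)"
      using \<Phi>e[OF x] by (metis mult_2 wronskian_add(1))
    moreover have "2 * wronskian (proj x) (\<Phi> (bracketW ?e y)) = wronskian (proj x) (D (\<Phi> y))"
      using \<Phi>e[OF y] by (metis mult_2 wronskian_add(2))
    \<comment> \<open>Here \<open>p\<close> and \<open>q\<close> are the two mixed terms of the
      claim. They occur once on the first side and twice on the second, while the terms
      \<open>a\<close> and \<open>b\<close> with \<open>D (\<Phi> x)\<close> and
      \<open>D (\<Phi> y)\<close> cancel.\<close>
    moreover have "p + q = 0"
      if "t = t1 + t2" "2 * t = d" "2 * d = (a + q) + (p + b)" "2 * t1 = a' + p" "2 * t2 = q + b'"
        "2 * a' = a" "2 * b' = b" for t t1 t2 d a a' b b' p q :: group_poly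
    proof -
      have "(a + q) + (p + b) = 2 * (2 * t1) + 2 * (2 * t2)"
        using that(1-3) by (metis distrib_left)
      also have "\<dots> = (a + (p + p)) + ((q + q) + b)"
        by (simp only: that(4,5) distrib_left that(6,7)) (simp only: mult_2)
      finally show ?thesis by (simp add: algebra_simps)
    qed
    ultimately show ?thesis
      unfolding D_pbr by blast
  qed
  have eigen: "D (\<Phi> x) = scalar (2 * \<alpha>) * \<Phi> x" if \<alpha>: "\<alpha> \<in> G" "\<alpha> \<noteq> 0" and x: "x \<in> What G" for \<alpha> x
  proof -
    define E where "E = Poly_Mapping.single (\<alpha>, 0::nat) (1::complex)"
    have \<alpha>2: "2 * \<alpha> \<in> G" using G \<alpha> by (metis complex_add_subgroup_def mult_2)
    have ce: "bracketW ?e (L \<beta> 0) = scaleW \<beta> (L \<beta> 0)" for \<beta>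
      by (simp add: bracketW_L_L)
    have D\<Phi>: "D (\<Phi> (L \<beta> 0)) = 2 * (scalar \<beta> * \<Phi> (L \<beta> 0))" if "\<beta> \<in> G" for \<beta>
      using \<Phi>e[OF L_in_What[OF that, of 0]] by (simp add: ce scale L_in_What[OF that])
    have p1: "proj (L \<alpha> 0) = E" and p2: "proj (L (2 * \<alpha>) 0) = E * E"
      by (simp_all add: E_def proj_L mult_single)
    have DE: "D E = scalar \<alpha> * E"
      by (simp add: E_def D_single mult_single)
    have s2: "scalar (2 * \<alpha>) = 2 * scalar \<alpha>"
      by (metis mult_2 single_add)
    \<comment> \<open>The monomial \<open>E\<close> is a unit, so it can be cancelled without an
      argument about zero divisors.\<close>
    have Einv: "Poly_Mapping.single (- \<alpha>, 0::nat) (1::complex) * E = 1"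
      by (simp add: E_def mult_single flip: zero_prod_def)
    have cancelE: "p = q" if "E * p = E * q" for p q
    proof -
      have "Poly_Mapping.single (- \<alpha>, 0::nat) (1::complex) * E * p = Poly_Mapping.single (- \<alpha>, 0::nat) 1 * E * q"
        unfolding mult.assoc that ..
      then show ?thesis by (simp add: Einv)
    qed
    \<comment> \<open>By \<open>D\<Phi>\<close>, the terms with \<open>\<Phi> (L \<alpha> 0)\<close>
      carry the factor 4\<alpha>^2 - 4\<alpha>^2 because the second exponent is exactly doubled;
      those with \<open>\<Phi> (L (2 * \<alpha>) 0)\<close> carry 4\<alpha>^2 - \<alpha>^2.\<close>
    have "scalar (3 * \<alpha> * \<alpha>) * (E * \<Phi> (L (2 * \<alpha>) 0)) = 0"
    proof -
      have s3: "scalar (3 * \<alpha> * \<alpha>) = 3 * scalar \<alpha> * scalar \<alpha>"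
        by (simp add: mult_single flip: single_numeral)
      have "scalar (3 * \<alpha> * \<alpha>) * (E * \<Phi> (L (2 * \<alpha>) 0)) =
          wronskian (D E) (\<Phi> (L (2 * \<alpha>) 0)) + wronskian (\<Phi> (L \<alpha> 0)) (D (E * E))"
        unfolding wronskian_def D\<Phi>[OF \<alpha>(1)] D\<Phi>[OF \<alpha>2] D_mult D_add DE D_scalar s2 s3
        by (simp add: algebra_simps)
      then show ?thesis
        using cross[OF L_in_What[OF \<alpha>(1)] L_in_What[OF \<alpha>2], of 0 0] by (simp add: p1 p2)
    qed
    then have "\<Phi> (L (2 * \<alpha>) 0) = 0"
      using \<alpha> scalar_mult_cancel[of "3 * \<alpha> * \<alpha>" _ 0] cancelE[of _ 0] by simp
    \<comment> \<open>One of the two terms of \<open>cross\<close> is now zero; the other is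
      2\<alpha> E^2 (D \<Phi> x - 2\<alpha> \<Phi> x).\<close>
    then have "wronskian (D (E * E)) (\<Phi> x) = 0"
      using cross[OF L_in_What[OF \<alpha>2] x, of 0] p2 by simp
    moreover have "scalar (2 * \<alpha>) * (E * (E * D (\<Phi> x))) -
        scalar (2 * \<alpha>) * (E * (E * (scalar (2 * \<alpha>) * \<Phi> x))) = wronskian (D (E * E)) (\<Phi> x)"
      unfolding wronskian_def D_mult D_add DE D_scalar s2 by (simp add: algebra_simps)
    ultimately have "scalar (2 * \<alpha>) * (E * (E * D (\<Phi> x))) =
        scalar (2 * \<alpha>) * (E * (E * (scalar (2 * \<alpha>) * \<Phi> x)))" by simp
    then show ?thesis using \<alpha>(2) by (auto simp: scalar_mult_cancel dest!: cancelE)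
  qed
  \<comment> \<open>Using \<alpha> and -\<alpha>, \<open>D\<close> acts on \<open>\<Phi> x\<close>
    by both 2\<alpha> and -2\<alpha>, which are distinct.\<close>
  obtain \<alpha> where \<alpha>: "\<alpha> \<in> G" "\<alpha> \<noteq> 0"
    using G nontrivial by (auto simp: complex_add_subgroup_def)
  then have "- \<alpha> \<in> G" using G by (simp add: complex_add_subgroup_def)
  then have "scalar (2 * \<alpha>) * \<Phi> x = scalar (- (2 * \<alpha>)) * \<Phi> x"
    using eigen[OF \<alpha> x] eigen[of "- \<alpha>", OF _ _ x] \<alpha> by simp
  then have "2 * \<alpha> * Poly_Mapping.lookup (\<Phi> x) k = - (2 * \<alpha>) * Poly_Mapping.lookup (\<Phi> x) k" for k
    by (metis lookup_scalar_mult)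
  then have "Poly_Mapping.lookup (\<Phi> x) k = 0" for k
    using \<alpha>(2) by simp
  then show ?thesis by (intro poly_mapping_eqI) simp
qed

section \<open>Back from the quotient: central components\<close>

lemma what_eqI:
  assumes "proj x = proj y" "Poly_Mapping.lookup x IC = Poly_Mapping.lookup y IC"
  shows "x = y"
proof (rule poly_mapping_eqI)
  fix k
  show "Poly_Mapping.lookup x k = Poly_Mapping.lookup y k"
    using assms by (cases k) (metis lookup_proj)+
qed

lemma lookup_L_IC [simp]: "Poly_Mapping.lookup (L \<alpha> i) IC = 0"
  by (simp add: L_def lookup_single)

lemma lookup_C [simp]: "Poly_Mapping.lookup C (IL \<alpha> i) = 0" "Poly_Mapping.lookup C IC = 1"
  by (simp_all add: C_def lookup_single)

lemma proj_diff: "proj (x - y) = proj x - proj y"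
  by (metis add_diff_cancel diff_add_cancel proj_add)

lemma proj_sum: "proj (sum f A) = (\<Sum>i\<in>A. proj (f i))"
  by (induction A rule: infinite_finite_induct) (simp_all add: proj_add)

lemma lookup_mult_single:
  "Poly_Mapping.lookup (p * Poly_Mapping.single (\<alpha>, i) 1) (\<gamma>, k) =
     (if i \<le> k then Poly_Mapping.lookup p (\<gamma> - \<alpha>, k - i) else 0)" for p :: group_poly
proof (induction p rule: poly_mapping_single_sum_induct)
  case (single l c)
  then show ?case by (cases l) (auto simp: mult_single lookup_single when_def)
qed (simp add: lookup_add algebra_simps)

text \<open>Only \<open>L (- \<beta>) 0\<close> pairs nontrivially with \<open>L \<beta> 0\<close>
  under the cocycle; putting -\<beta> for \<alpha> turns \<alpha>^3 - \<alpha> into \<beta> -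
  \<beta>^3.\<close>

lemma lookup_bracketW_L_IC:
  "Poly_Mapping.lookup (bracketW x (L \<beta> j)) IC =
     (if j = 0 then Poly_Mapping.lookup x (IL (- \<beta>) 0) * ((\<beta> - \<beta> ^ 3) / 12) else 0)"
proof (induction x rule: what_induct)
  case (add_L c \<alpha> i x)
  have "Poly_Mapping.lookup (bracketW (L \<alpha> i) (L \<beta> j)) IC =
      (if j = 0 then Poly_Mapping.lookup (L \<alpha> i) (IL (- \<beta>) 0) * ((\<beta> - \<beta> ^ 3) / 12) else 0)"
    unfolding bracketW_L_L by (auto simp: lookup_add L_def C_def lookup_single when_def)
  with add_L show ?case
    by (simp add: bracketW_add_left bracketW_scale_left lookup_add algebra_simps)
qed (simp_all add: bracketW_add_left bracketW_scale_left lookup_add)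

text \<open>The cocycle sees only t-degree 0. This is why summands with k \<ge> 1 create no central
  terms.\<close>

lemma lookup_bracketW_IC_eq_0:
  assumes "\<And>\<gamma>. Poly_Mapping.lookup x (IL \<gamma> 0) = 0"
  shows "Poly_Mapping.lookup (bracketW x y) IC = 0" "Poly_Mapping.lookup (bracketW y x) IC = 0"
proof -
  show "Poly_Mapping.lookup (bracketW x y) IC = 0"
    by (induction y rule: what_induct)
       (simp_all add: bracketW_add_right bracketW_scale_right lookup_add lookup_bracketW_L_IC assms)
  then show "Poly_Mapping.lookup (bracketW y x) IC = 0"
    by (simp add: bracketW_skew[of y])
qed

lemma half_scale: "2 * (scalar (1/2) * p) = p"
proof -
  have "2 * scalar (1/2) = 1"
    by (simp add: mult_single flip: single_numeral)
  then show ?thesis by (simp flip: mult.assoc)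
qed

text \<open>By \<open>wronskian_mult\<close>, subtracting multiplication by
  \<open>proj (\<psi> (L 0 0))\<close> preserves the half-derivation rule; the difference vanishes
  at \<open>L 0 0\<close>, whose projection is 1.\<close>

lemma half_derivation_proj:
  assumes G: "complex_add_subgroup G" "G \<noteq> {0}"
    and \<psi>: "half_derivation_on scaleW (What G) bracketW \<psi>" and x: "x \<in> What G"
  shows "proj (\<psi> x) = proj (\<psi> (L 0 0)) * proj x"
proof -
  let ?u = "proj (\<psi> (L 0 0))"
  have one: "proj (L 0 0) = 1" by (simp add: proj_L flip: zero_prod_def)
  have "proj (\<psi> x) - ?u * proj x = 0"
  proof (rule half_derivation_rigid[OF G _ _ _ _ x])
    fix x y assume xy: "x \<in> What G" "y \<in> What G"
    show "proj (\<psi> (x + y)) - ?u * proj (x + y) =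
        (proj (\<psi> x) - ?u * proj x) + (proj (\<psi> y) - ?u * proj y)"
      using \<psi> xy by (simp add: half_derivation_on_def linear_map_on_def proj_add algebra_simps)
    have "2 * proj (\<psi> (bracketW x y)) = wronskian (proj (\<psi> x)) (proj y) + wronskian (proj x) (proj (\<psi> y))"
      using \<psi> xy by (simp add: half_derivation_on_def proj_scale proj_add half_scale proj_bracketW)
    then show "2 * (proj (\<psi> (bracketW x y)) - ?u * proj (bracketW x y)) =
        wronskian (proj (\<psi> x) - ?u * proj x) (proj y) + wronskian (proj x) (proj (\<psi> y) - ?u * proj y)"
      using wronskian_mult[of ?u "proj x" "proj y", symmetric]
      by (simp add: right_diff_distrib wronskian_diff proj_bracketW)
  next
    fix c x assume "x \<in> What G"
    then show "proj (\<psi> (scaleW c x)) - ?u * proj (scaleW c x) = scalar c * (proj (\<psi> x) - ?u * proj x)"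
      using \<psi> by (simp add: half_derivation_on_def linear_map_on_def proj_scale algebra_simps)
  qed (simp add: one)
  then show ?thesis by simp
qed

text \<open>The \<open>IC\<close> coefficients of the half-derivation rule on basis elements give
  linear equations between the central part of \<open>\<psi>\<close> and the t-free coefficients of
  \<open>u\<close>; suitable pairs of basis elements solve them.\<close>

lemma half_derivation_central:
  assumes G: "complex_add_subgroup G" "G \<noteq> {0}"
    and \<psi>: "half_derivation_on scaleW (What G) bracketW \<psi>"
    and u: "\<And>x. x \<in> What G \<Longrightarrow> proj (\<psi> x) = u * proj x"
  shows "\<And>\<alpha> i. \<alpha> \<in> G \<Longrightarrow> Poly_Mapping.lookup (\<psi> (L \<alpha> i)) IC = 0"
    and "\<And>d. d \<in> G \<Longrightarrow> d \<noteq> 0 \<Longrightarrow> Poly_Mapping.lookup u (d, 0) = 0"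
    and "\<psi> C = scaleW (Poly_Mapping.lookup u (0, 0)) C"
proof -
  define f where "f x = Poly_Mapping.lookup (\<psi> x) IC" for x
  define a where "a d = Poly_Mapping.lookup u (d, 0)" for d
  have G0: "0 \<in> G" and Gadd: "\<And>x y. x \<in> G \<Longrightarrow> y \<in> G \<Longrightarrow> x + y \<in> G" and Gneg: "\<And>x. x \<in> G \<Longrightarrow> - x \<in> G"
    using G by (auto simp: complex_add_subgroup_def)
  obtain g where g: "g \<in> G" "g \<noteq> 0" using G G0 by auto
  note sub = scaleW.subspace_add[OF subspace_What] scaleW.subspace_scale[OF subspace_What]
  have f_add: "f (x + y) = f x + f y" and f_scale: "f (scaleW c x) = c * f x"
    if "x \<in> What G" "y \<in> What G" for x y c
    using \<psi> that by (auto simp: f_def half_derivation_on_def linear_map_on_def lookup_add)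
  \<comment> \<open>Multiplying by a monomial of t-degree i raises t-degrees by i, so a t-free part
    survives only for i = 0, shifted by \<alpha>.\<close>
  have low: "Poly_Mapping.lookup (\<psi> (L \<alpha> i)) (IL \<gamma> 0) = (if i = 0 then a (\<gamma> - \<alpha>) else 0)"
    if "\<alpha> \<in> G" for \<alpha> i \<gamma>
    using u[OF L_in_What[OF that, of i]] 
    by (simp add: lookup_mult_single proj_L a_def flip: lookup_proj)
  \<comment> \<open>The 24 is the 12 of the cocycle times the 2 of the half-derivation rule. Both
    brackets on the right pick out the same coefficient of \<open>u\<close>, at -\<alpha> -
    \<beta>.\<close>
  have cocycle: "(\<beta> - \<alpha>) * f (L (\<alpha> + \<beta>) (i + j)) + (of_nat j - of_nat i) * f (L (\<alpha> + \<beta>) (i + j + 1))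
      + (if \<alpha> + \<beta> = 0 \<and> i + j = 0 then (\<alpha> ^ 3 - \<alpha>) / 12 * f C else 0)
    = (if i + j = 0 then a (- \<alpha> - \<beta>) * ((\<beta> - \<beta> ^ 3) - (\<alpha> - \<alpha> ^ 3)) / 24 else 0)"
    if ab: "\<alpha> \<in> G" "\<beta> \<in> G" for \<alpha> \<beta> i j
  proof -
    have eq: "\<alpha> = - \<beta> \<and> int i = - int j \<longleftrightarrow> \<alpha> + \<beta> = 0 \<and> i + j = 0"
      by (auto simp: eq_neg_iff_add_eq_0)
    have if0: "(if P then scaleW s C else 0) = scaleW (if P then s else 0) C" for P s
      by simp
    have "f (bracketW (L \<alpha> i) (L \<beta> j)) = (\<beta> - \<alpha>) * f (L (\<alpha> + \<beta>) (i + j))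
        + (of_nat j - of_nat i) * f (L (\<alpha> + \<beta>) (i + j + 1))
        + (if \<alpha> + \<beta> = 0 \<and> i + j = 0 then (\<alpha> ^ 3 - \<alpha>) / 12 * f C else 0)"
      unfolding bracketW_L_L eq if0
      using L_in_What[OF Gadd[OF ab]] C_in_What[of G] sub
      by (simp add: f_add f_scale)
    moreover have "f (bracketW (L \<alpha> i) (L \<beta> j)) =
        1/2 * (Poly_Mapping.lookup (bracketW (\<psi> (L \<alpha> i)) (L \<beta> j)) IC
             + Poly_Mapping.lookup (bracketW (L \<alpha> i) (\<psi> (L \<beta> j))) IC)"
      using \<psi> ab L_in_What by (simp add: f_def half_derivation_on_def lookup_add)
    moreover have "1/2 * (Poly_Mapping.lookup (bracketW (\<psi> (L \<alpha> i)) (L \<beta> j)) IC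
             + Poly_Mapping.lookup (bracketW (L \<alpha> i) (\<psi> (L \<beta> j))) IC) =
        (if i + j = 0 then a (- \<alpha> - \<beta>) * ((\<beta> - \<beta> ^ 3) - (\<alpha> - \<alpha> ^ 3)) / 24 else 0)"
    proof -
      have "a (- \<beta> - \<alpha>) = a (- \<alpha> - \<beta>)"
        by (rule arg_cong[of _ _ a]) simp
      then obtain r where "a (- \<alpha> - \<beta>) = r" "a (- \<beta> - \<alpha>) = r" by blast
      then show ?thesis
        unfolding bracketW_skew[of "L \<alpha> i" "\<psi> (L \<beta> j)"] lookup_bracketW_L_IC lookup_uminus
        by (cases "i = 0"; cases "j = 0") (simp_all add: low ab, simp add: field_simps)
    qed
    ultimately show ?thesis by argo
  qed
  have \<psi>C: "\<psi> C = scaleW (f C) C"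
    by (rule what_eqI) (simp_all add: u C_in_What proj_scale f_def)
  \<comment> \<open>In the recursion below the right side is independent of \<alpha>; comparing
    \<alpha> = 0 with \<alpha> = g leaves 2 g f = 0.\<close>
  have high: "f (L \<gamma> n) = 0" if "\<gamma> \<in> G" "n > 0" for \<gamma> n
  proof -
    have "(\<gamma> - 2 * \<alpha>) * f (L \<gamma> n) = of_nat n * f (L \<gamma> (n + 1))" if "\<alpha> \<in> G" for \<alpha>
      using cocycle[of \<alpha> "\<gamma> - \<alpha>" n 0] Gadd[OF \<open>\<gamma> \<in> G\<close> Gneg[OF that]] that \<open>n > 0\<close>
      by (simp add: algebra_simps)
    from this[OF G0] this[OF g(1)] show ?thesis using g(2) by (simp add: algebra_simps)
  qed
  \<comment> \<open>The pairs (0, \<gamma>) and (-\<gamma>, 2\<gamma>) have the same sum, hence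
    involve the same two unknowns; eliminating f leaves a multiple of \<gamma>^3.\<close>
  have low0: "f (L \<gamma> 0) = 0 \<and> a (- \<gamma>) = 0" if \<gamma>: "\<gamma> \<in> G" "\<gamma> \<noteq> 0" for \<gamma>
  proof -
    have 1: "\<gamma> * f (L \<gamma> 0) = a (- \<gamma>) * (\<gamma> - \<gamma> ^ 3) / 24"
      using cocycle[of 0 \<gamma> 0 0] G0 \<gamma> by simp
    have 2: "3 * \<gamma> * f (L \<gamma> 0) = a (- \<gamma>) * (3 * \<gamma> - 9 * \<gamma> ^ 3) / 24"
      using cocycle[of "- \<gamma>" "2 * \<gamma>" 0 0] Gneg \<gamma> Gadd[OF \<gamma>(1) \<gamma>(1)] by (simp add: algebra_simps power_mult_distrib)
    have "6 * (a (- \<gamma>) * \<gamma> ^ 3) = 0" using 1 2 by algebra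
    then have "a (- \<gamma>) = 0" using \<gamma> by simp
    with 1 \<gamma> show ?thesis by simp
  qed
  \<comment> \<open>For the pairs (\<alpha>, -\<alpha>) take \<alpha> = g and \<alpha> = 2g:
    subtracting twice the first equation from the second removes the linear terms and leaves 8 g^3 -
    2 g^3.\<close>
  have zero: "f (L 0 0) = 0 \<and> f C = a 0"
  proof -
    have eq: "(f C - a 0) * (\<alpha> ^ 3 - \<alpha>) = 24 * \<alpha> * f (L 0 0)" if "\<alpha> \<in> G" for \<alpha>
    proof -
      have "(- \<alpha> - \<alpha>) * f (L 0 0) + (\<alpha> ^ 3 - \<alpha>) / 12 * f C =
          a 0 * ((- \<alpha> - (- \<alpha>) ^ 3) - (\<alpha> - \<alpha> ^ 3)) / 24"
        using cocycle[of \<alpha> "- \<alpha>" 0 0] Gneg that by simp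
      then show ?thesis by algebra
    qed
    have "(f C - a 0) * (6 * g ^ 3) = 0"
      using eq[OF g(1)] eq[OF Gadd[OF g(1) g(1)]] by algebra
    then have "f C = a 0" using g by simp
    with eq[OF g(1)] g show ?thesis by simp
  qed
  show "Poly_Mapping.lookup (\<psi> (L \<alpha> i)) IC = 0" if "\<alpha> \<in> G" for \<alpha> i
    using high low0 zero that f_def by (metis gr0I)
  show "Poly_Mapping.lookup u (d, 0) = 0" if "d \<in> G" "d \<noteq> 0" for d
    using low0[of "- d"] that Gneg a_def by simp
  show "\<psi> C = scaleW (Poly_Mapping.lookup u (0, 0)) C"
    using \<psi>C zero a_def by simp
qed

section \<open>The converse and the equivalence\<close>

text \<open>Modulo \<open>C\<close> this is \<open>wronskian_mult\<close>. Both central components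
  vanish: the left one by \<open>IC\<close>, the right one because \<open>\<phi> x\<close> and
  \<open>\<phi> y\<close> have no t-free part for the cocycle to pair.\<close>

lemma half_derivation_on_multiplication:
  assumes G: "complex_add_subgroup G"
    and \<phi>: "linear_map_on scaleW (What G) \<phi>"
    and u: "\<And>x. x \<in> What G \<Longrightarrow> proj (\<phi> x) = u * proj x"
    and low: "\<And>x \<gamma>. x \<in> What G \<Longrightarrow> Poly_Mapping.lookup (\<phi> x) (IL \<gamma> 0) = 0"
    and IC: "\<And>x. x \<in> What G \<Longrightarrow> Poly_Mapping.lookup (\<phi> x) IC = 0"
  shows "half_derivation_on scaleW (What G) bracketW \<phi>"
proof -
  have "\<phi> (bracketW x y) = scaleW (1/2) (bracketW (\<phi> x) y + bracketW x (\<phi> y))"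
    if "x \<in> What G" "y \<in> What G" for x y
  proof (rule what_eqI)
    have "wronskian (proj (\<phi> x)) (proj y) + wronskian (proj x) (proj (\<phi> y)) = 2 * proj (\<phi> (bracketW x y))"
      using wronskian_mult[of u "proj x" "proj y"] that bracketW_in_What[OF G that]
      by (simp add: u proj_bracketW)
    then show "proj (\<phi> (bracketW x y)) = proj (scaleW (1/2) (bracketW (\<phi> x) y + bracketW x (\<phi> y)))"
      by (simp add: proj_scale proj_add proj_bracketW half_scale mult.left_commute[of _ 2])
    show "Poly_Mapping.lookup (\<phi> (bracketW x y)) IC =
        Poly_Mapping.lookup (scaleW (1/2) (bracketW (\<phi> x) y + bracketW x (\<phi> y))) IC"
      using that by (simp add: IC bracketW_in_What[OF G] lookup_add lookup_bracketW_IC_eq_0 low)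
  qed
  with \<phi> show ?thesis by (simp add: half_derivation_on_def)
qed

theorem theorem13:
  fixes G :: "complex set" and \<psi> :: "what \<Rightarrow> what"
  assumes "complex_add_subgroup G" and "G \<noteq> {0}"
    and "linear_map_on scaleW (What G) \<psi>"
  shows "half_derivation_on scaleW (What G) bracketW \<psi> \<longleftrightarrow>
    (\<exists>(c :: complex) (\<phi> :: what \<Rightarrow> what) (a :: complex \<Rightarrow> nat \<Rightarrow> complex).
       finite {(d, k). d \<in> G \<and> k \<ge> 1 \<and> a d k \<noteq> 0} \<and>
       linear_map_on scaleW (What G) \<phi> \<and>
       (\<forall>\<alpha>\<in>G. \<forall>i. \<phi> (L \<alpha> i) =
          (\<Sum>(d, k)\<in>{(d, k). d \<in> G \<and> k \<ge> 1 \<and> a d k \<noteq> 0}. scaleW (a d k) (L (\<alpha> + d) (i + k)))) \<and>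
       \<phi> C = 0 \<and>
       (\<forall>x\<in>What G. \<psi> x = scaleW c x + \<phi> x))"
    (is "?half \<longleftrightarrow> ?form")
proof
  assume \<psi>: ?half
  \<comment> \<open>\<open>u\<close> is the multiplier and \<open>c\<close> its constant
    coefficient, so \<open>\<phi>\<close> will be multiplication by the part of positive
    t-degree.\<close>
  define u where "u = proj (\<psi> (L 0 0))"
  define c where "c = Poly_Mapping.lookup u (0, 0)"
  define a where "a d k = Poly_Mapping.lookup u (d, k)" for d k
  define \<phi> where "\<phi> x = \<psi> x - scaleW c x" for x
  define S where "S = {(d, k). d \<in> G \<and> k \<ge> 1 \<and> a d k \<noteq> 0}"
  have u: "proj (\<psi> x) = u * proj x" if "x \<in> What G" for x
    using half_derivation_proj[OF assms(1,2) \<psi> that] by (simp add: u_def)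
  have IC: "Poly_Mapping.lookup (\<psi> (L \<alpha> i)) IC = 0" if "\<alpha> \<in> G" for \<alpha> i
    using half_derivation_central(1)[OF assms(1,2) \<psi> u] that by blast
  have low: "Poly_Mapping.lookup u (d, 0) = 0" if "d \<in> G" "d \<noteq> 0" for d
    using half_derivation_central(2)[OF assms(1,2) \<psi> u] that by blast
  have \<psi>C: "\<psi> C = scaleW c C"
    unfolding c_def using half_derivation_central(3)[OF assms(1,2) \<psi> u] by blast
  have fin: "finite S"
    by (rule finite_subset[of _ "Poly_Mapping.keys u"]) (auto simp: S_def a_def in_keys_iff)
  have lin: "linear_map_on scaleW (What G) \<phi>"
    using assms(3) unfolding linear_map_on_def \<phi>_def
    by (auto simp: scaleW.scale_right_distrib scaleW.scale_right_diff_distrib mult.commute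
        intro!: scaleW.subspace_diff[OF subspace_What] scaleW.subspace_scale[OF subspace_What])
  have \<psi>0: "\<psi> (L 0 0) \<in> What G"
    using assms(1,3) L_in_What by (simp add: complex_add_subgroup_def linear_map_on_def)
  have supp: "Poly_Mapping.lookup u (d, k) = 0" if "d \<notin> G" for d k
    using \<psi>0 that by (auto simp: u_def What_def in_keys_iff dest!: subsetD[of _ _ "IL d k"])
  \<comment> \<open>\<open>supp\<close> excludes exponents outside \<open>G\<close> and
    \<open>low\<close> the t-free nonconstant ones, so only the constant and \<open>S\<close>
    remain.\<close>
  have u_eq: "u = scalar c + (\<Sum>p\<in>S. Poly_Mapping.single p (case_prod a p))"
  proof (rule poly_mapping_eqI)
    fix p :: "complex \<times> nat"
    obtain d k where p: "p = (d, k)" by fastforce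
    have "Poly_Mapping.lookup (\<Sum>p\<in>S. Poly_Mapping.single p (case_prod a p)) p =
        (if p \<in> S then case_prod a p else 0)"
      using fin by (simp add: lookup_sum lookup_single when_def)
    then show "Poly_Mapping.lookup u p =
        Poly_Mapping.lookup (scalar c + (\<Sum>p\<in>S. Poly_Mapping.single p (case_prod a p))) p"
      using supp low[of d]
      by (auto simp: p lookup_add lookup_single when_def zero_prod_def c_def S_def a_def not_less_eq_eq)
  qed
  have L: "\<phi> (L \<alpha> i) = (\<Sum>(d, k)\<in>S. scaleW (a d k) (L (\<alpha> + d) (i + k)))" if "\<alpha> \<in> G" for \<alpha> i
  proof (rule what_eqI)
    have "proj (\<phi> (L \<alpha> i)) = (u - scalar c) * Poly_Mapping.single (\<alpha>, i) 1"
      by (simp add: \<phi>_def proj_diff proj_scale u L_in_What that proj_L left_diff_distrib)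
    also have "\<dots> = (\<Sum>p\<in>S. Poly_Mapping.single p (case_prod a p) * Poly_Mapping.single (\<alpha>, i) 1)"
      by (simp add: u_eq sum_distrib_right)
    also have "\<dots> = proj (\<Sum>(d, k)\<in>S. scaleW (a d k) (L (\<alpha> + d) (i + k)))"
      unfolding proj_sum
      by (rule sum.cong) (auto simp: mult_single proj_scale proj_L zero_prod_def add.commute)
    finally show "proj (\<phi> (L \<alpha> i)) = proj (\<Sum>(d, k)\<in>S. scaleW (a d k) (L (\<alpha> + d) (i + k)))" .
    show "Poly_Mapping.lookup (\<phi> (L \<alpha> i)) IC =
        Poly_Mapping.lookup (\<Sum>(d, k)\<in>S. scaleW (a d k) (L (\<alpha> + d) (i + k))) IC"
      using IC[OF that] by (simp add: \<phi>_def lookup_minus lookup_sum case_prod_unfold)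
  qed
  have "\<phi> C = 0" by (simp add: \<phi>_def \<psi>C)
  moreover have "\<psi> x = scaleW c x + \<phi> x" for x by (simp add: \<phi>_def)
  ultimately show ?form
    using fin lin L unfolding S_def by blast
next
  assume ?form
  then obtain c \<phi> a where
    lin: "linear_map_on scaleW (What G) \<phi>"
    and L: "\<And>\<alpha> i. \<alpha> \<in> G \<Longrightarrow> \<phi> (L \<alpha> i) =
      (\<Sum>(d, k)\<in>{(d, k). d \<in> G \<and> k \<ge> 1 \<and> a d k \<noteq> 0}. scaleW (a d k) (L (\<alpha> + d) (i + k)))"
    and C: "\<phi> C = 0" and \<psi>: "\<And>x. x \<in> What G \<Longrightarrow> \<psi> x = scaleW c x + \<phi> x"
    by blast
  define S where "S = {(d, k). d \<in> G \<and> k \<ge> 1 \<and> a d k \<noteq> 0}"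
  define u where "u = (\<Sum>p\<in>S. Poly_Mapping.single p (case_prod a p))"
  note What = scaleW.subspace_scale[OF subspace_What] L_in_What C_in_What
  have "\<phi> 0 = 0"
    using lin scaleW.subspace_0[OF subspace_What, of G] unfolding linear_map_on_def
    by (metis scaleW.scale_zero_left)
  have \<phi>L: "\<phi> (scaleW b (L \<alpha> i) + x) = scaleW b (\<phi> (L \<alpha> i)) + \<phi> x"
    and \<phi>C: "\<phi> (scaleW b C + x) = \<phi> x" if "x \<in> What G" "\<alpha> \<in> G" for b \<alpha> i x
    using lin that C What unfolding linear_map_on_def by auto
  have G0: "0 \<in> G" using assms(1) by (simp add: complex_add_subgroup_def)
  \<comment> \<open>These are the three premises of
    \<open>half_derivation_on_multiplication\<close>. On basis elements the second one holds because
    i + k \<ge> 1.\<close>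
  have inv: "proj (\<phi> x) = u * proj x \<and> (\<forall>\<gamma>. Poly_Mapping.lookup (\<phi> x) (IL \<gamma> 0) = 0) \<and>
      Poly_Mapping.lookup (\<phi> x) IC = 0" if "x \<in> What G" for x
    using that
  proof (induction rule: What_induct)
    case (add_L b \<alpha> i x)
    have "proj (\<phi> (L \<alpha> i)) = u * proj (L \<alpha> i)"
      unfolding L[OF add_L(1)] S_def[symmetric] u_def proj_sum sum_distrib_right
      by (rule sum.cong) (auto simp: mult_single proj_scale proj_L zero_prod_def add.commute)
    moreover have "Poly_Mapping.lookup (\<phi> (L \<alpha> i)) (IL \<gamma> 0) = 0" for \<gamma>
      unfolding L[OF add_L(1)] lookup_sum by (rule sum.neutral) (auto simp: L_def lookup_single)
    moreover have "Poly_Mapping.lookup (\<phi> (L \<alpha> i)) IC = 0"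
      unfolding L[OF add_L(1)] lookup_sum by (rule sum.neutral) auto
    ultimately show ?case
      using add_L by (simp add: \<phi>L lookup_add proj_add proj_scale distrib_left mult.left_commute)
  next
    case (add_C b x)
    then show ?case by (simp add: \<phi>C[OF _ G0] proj_add proj_scale)
  qed (simp add: \<open>\<phi> 0 = 0\<close>)
  then have half: "half_derivation_on scaleW (What G) bracketW \<phi>"
    using half_derivation_on_multiplication[OF assms(1) lin] by blast
  have "\<psi> (bracketW x y) = scaleW (1/2) (bracketW (\<psi> x) y + bracketW x (\<psi> y))"
    if "x \<in> What G" "y \<in> What G" for x y
  proof -
    \<comment> \<open>The scalar part contributes c [x, y] from each argument, and the factor 1/2
      restores a single copy.\<close>
    have two: "scaleW (1/2) (z + z) = z" for z
      by (rule poly_mapping_eqI) (simp add: lookup_add)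
    have "scaleW (1/2) (bracketW (\<psi> x) y + bracketW x (\<psi> y)) =
        scaleW (1/2) (scaleW c (bracketW x y) + scaleW c (bracketW x y))
        + scaleW (1/2) (bracketW (\<phi> x) y + bracketW x (\<phi> y))"
      unfolding \<psi>[OF that(1)] \<psi>[OF that(2)] bracketW_add_left bracketW_add_right
        bracketW_scale_left bracketW_scale_right scaleW.scale_right_distrib by (simp only: add_ac)
    then show ?thesis
      using half that by (simp add: two \<psi> bracketW_in_What[OF assms(1)] half_derivation_on_def)
  qed
  with assms(3) show ?half by (simp add: half_derivation_on_def)
qed

end
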